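(* Let $\phi(x):=f(x,\pi^*(x))$ with $f(x,\pi)=\mathbb{E}_{d_i\sim\rho(d;\pi)}[l(d_1,\dots,d_I;x)]$. Then the hyper-gradient $\nabla\phi(x)$ can be computed by $$\nabla\phi(x)=\mathbb{E}_{d_i\sim\rho(d;\pi^*(x))}\left[\nabla l(d_1,\dots,d_I;x)\right]+\tau^{-1}\,\mathbb{E}_{d_i\sim\rho(d;\pi^*(x))}\Big[l(d_1,\dots,d_I;x)\Big(\sum_{i=1}^I\sum_{h=0}^{H-1}\nabla\big(Q^*_{s_h^ia_h^i}(x)-V^*_{s_h^i}(x)\big)\Big)\Big].$$
   Context: Lower level. Let $\mathcal{S},\mathcal{A}$ be finite nonempty sets, $P_{sas'}=P(s'|s,a)$ a transition kernel, $\gamma\in(0,1)$, $\tau>0$, and $r:\mathbb{R}^n\to\mathbb{R}^{|\mathcal{S}||\mathcal{A}|}$ a continuously differentiable parameterized reward. A policy is $\pi=(\pi_s)_{s\in\mathcal{S}}$ with each $\pi_s=\pi(\cdot|s)$ a probability distribution on $\mathcal{A}$. With $h(\pi_s)=-\sum_a\pi_{sa}\log\pi_{sa}$ (convention $0\log0=0$), $V^\pi_s(x)=\mathbb{E}[\sum_{t\ge0}\gamma^t(r_{s_ta_t}(x)+\tau h(\pi_{s_t}))\mid s_0=s,\pi]$ (trajectories with $a_t\sim\pi(\cdot|s_t)$, $s_{t+1}\sim P(\cdot|s_t,a_t)$) and $Q^\pi_{sa}(x)=r_{sa}(x)+\gamma\sum_{s'}P_{sas'}V^\pi_{s'}(x)$.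 Let $\rho$ be a distribution on $\mathcal{S}$ with all entries positive; $\pi^*(x)$ is the unique maximizer over all policies of $\sum_s\rho_sV^\pi_s(x)$, $V^*(x)=V^{\pi^*(x)}(x)$, $Q^*(x)=Q^{\pi^*(x)}(x)$; $\nabla V^*_s$, $\nabla Q^*_{sa}$ denote gradients in $x$ of these functions. Upper level. $\bar P$ is a transition kernel and $\bar\rho$ an initial distribution on the same $\mathcal{S},\mathcal{A}$; $I,H\ge1$ are integers. For a policy $\pi$, $\rho(d;\pi)$ is the distribution on $H$-step trajectories $d=\{(s_h,a_h)\}_{h=0}^{H-1}$ given by $$P(d;\pi)=\bar\rho(s_0)\Big[\prod_{h=0}^{H-2}\pi(a_h|s_h)\bar P(s_{h+1}|s_h,a_h)\Big]\pi(a_{H-1}|s_{H-1}).$$ $\mathbb{E}_{d_i\sim\rho(d;\pi)}$ is the expectation with $d_1,\dots,d_I$ drawn independently from $\rho(d;\pi)$, $d_i=\{(s_h^i,a_h^i)\}_{h=0}^{H-1}$. The function $l(d_1,\dots,d_I;x)$ is real valued, continuously differentiable in $x$; $\nabla l$ is its gradient in $x$ for fixed trajectories. *)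

theory Defs
  imports "HOL-Probability.Probability"
begin

text \<open>The value is meaningful only where \<open>f\<close> is differentiable.\<close>

definition grad :: "('x::euclidean_space \<Rightarrow> real) \<Rightarrow> 'x \<Rightarrow> 'x" where
  "grad f x = (THE D. GDERIV f x :> D)"

definition cont_diff :: "('x::euclidean_space \<Rightarrow> real) \<Rightarrow> bool" where
  "cont_diff f \<longleftrightarrow> (\<forall>x. f differentiable (at x)) \<and> continuous_on UNIV (grad f)"

lemma differentiable_GDERIV:
  fixes f :: "'x::euclidean_space \<Rightarrow> real"
  assumes "f differentiable (at x)"
  shows "\<exists>!D. GDERIV f x :> D"
proof -
  obtain f' where f': "(f has_derivative f') (at x)"
    using assms by (auto simp: differentiable_def)
  interpret linear f'
    using f' by (rule has_derivative_linear)
  define D where "D = (\<Sum>b\<in>Basis. f' b *\<^sub>R b)"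
  have "f' = (\<lambda>h. inner h D)"
  proof
    fix h :: 'x
    have "f' h = f' (\<Sum>b\<in>Basis. inner h b *\<^sub>R b)"
      by (simp add: euclidean_representation)
    also have "\<dots> = inner h D"
      by (simp add: sum scale D_def inner_sum_right mult.commute)
    finally show "f' h = inner h D" .
  qed
  then have "GDERIV f x :> D"
    using f' by (simp add: gderiv_def)
  moreover have "D' = D" if "GDERIV f x :> D'" for D'
  proof -
    have "(\<lambda>h. inner h D') = (\<lambda>h. inner h D)"
      using that \<open>GDERIV f x :> D\<close> unfolding gderiv_def by (rule has_derivative_unique)
    then have "inner h (D' - D) = 0" for h
      by (metis inner_diff_right right_minus_eq)
    then show ?thesis
      by (metis inner_eq_zero_iff right_minus_eq)
  qed
  ultimately show ?thesis by blast
qed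

lemma GDERIV_grad:
  fixes f :: "'x::euclidean_space \<Rightarrow> real"
  assumes "f differentiable (at x)"
  shows "GDERIV f x :> grad f x"
  unfolding grad_def using differentiable_GDERIV[OF assms] by (rule theI')

type_synonym ('s, 'a) policy = "'s \<Rightarrow> 'a pmf"
type_synonym ('s, 'a) kernel = "'s \<Rightarrow> 'a \<Rightarrow> 's pmf"

text \<open>The convention \<open>0 log 0 = 0\<close> holds automatically, the product being zero.\<close>

definition policy_entropy :: "'a::finite pmf \<Rightarrow> real" where
  "policy_entropy p = - (\<Sum>a\<in>UNIV. pmf p a * ln (pmf p a))"

text \<open>Conditional law of \<open>(s\<^sub>t, a\<^sub>t)\<close> given the past \<open>\<omega> 0, \<dots>, \<omega> (t - 1)\<close>, for
  trajectories started in \<open>s\<close>.\<close>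

definition step_pmf ::
  "('s, 'a) kernel \<Rightarrow> ('s, 'a) policy \<Rightarrow> 's \<Rightarrow> nat \<Rightarrow> (nat \<Rightarrow> 's \<times> 'a) \<Rightarrow> ('s \<times> 'a) pmf" where
  "step_pmf P \<pi> s t \<omega> =
     bind_pmf (if t = 0 then return_pmf s else P (fst (\<omega> (t - 1))) (snd (\<omega> (t - 1))))
       (\<lambda>s'. map_pmf (Pair s') (\<pi> s'))"

text \<open>Law of the infinite trajectory \<open>(s\<^sub>t, a\<^sub>t)\<^sub>t\<close> started in \<open>s\<close>: the projective limit given by the
  Ionescu-Tulcea theorem.\<close>

definition run_measure ::
  "('s, 'a) kernel \<Rightarrow> ('s, 'a) policy \<Rightarrow> 's \<Rightarrow> (nat \<Rightarrow> 's \<times> 'a) measure" where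
  "run_measure P \<pi> s =
     projective_family.lim UNIV
       (Ionescu_Tulcea.CI (\<lambda>t \<omega>. measure_pmf (step_pmf P \<pi> s t \<omega>)) (\<lambda>_. count_space UNIV))
       (\<lambda>_. count_space UNIV)"

lemma Ionescu_Tulcea_step:
  fixes P :: "('s::finite, 'a::finite) kernel"
  shows "Ionescu_Tulcea (\<lambda>t \<omega>. measure_pmf (step_pmf P \<pi> s t \<omega>)) (\<lambda>_. count_space UNIV)"
proof
  fix t :: nat
  show "(\<lambda>\<omega>. measure_pmf (step_pmf P \<pi> s t \<omega>))
      \<in> PiM {0..<t} (\<lambda>_. count_space UNIV) \<rightarrow>\<^sub>M subprob_algebra (count_space UNIV)"
  proof (cases t)
    case 0
    then show ?thesis
      by (simp add: step_pmf_def measure_pmf_in_subprob_algebra)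
  next
    case (Suc n)
    define k where "k = (\<lambda>y. measure_pmf (bind_pmf (P (fst y) (snd y)) (\<lambda>s'. map_pmf (Pair s') (\<pi> s'))))"
    have "(\<lambda>\<omega>. \<omega> n) \<in> PiM {0..<t} (\<lambda>_. count_space UNIV) \<rightarrow>\<^sub>M count_space (UNIV :: ('s \<times> 'a) set)"
      using Suc by (intro measurable_component_singleton) auto
    moreover have "k \<in> count_space UNIV \<rightarrow>\<^sub>M subprob_algebra (count_space UNIV)"
      by (simp add: k_def measure_pmf_in_subprob_algebra)
    ultimately have "k \<circ> (\<lambda>\<omega>. \<omega> n) \<in> PiM {0..<t} (\<lambda>_. count_space UNIV) \<rightarrow>\<^sub>M subprob_algebra (count_space UNIV)"
      by (rule measurable_comp)
    then show ?thesis
      using Suc by (simp add: k_def step_pmf_def comp_def)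
  qed
qed

lemma pmf_step_pmf:
  fixes P :: "('s::finite, 'a::finite) kernel"
  shows "pmf (step_pmf P \<pi> s t \<omega>) (s', a') =
     (if t = 0 then of_bool (s' = s) else pmf (P (fst (\<omega> (t - 1))) (snd (\<omega> (t - 1)))) s') *
     pmf (\<pi> s') a'"
proof -
  have *: "pmf (map_pmf (Pair u) (\<pi> u)) (s', a') = of_bool (u = s') * pmf (\<pi> s') a'" for u
  proof (cases "u = s'")
    case True
    then show ?thesis
      by (simp add: pmf_map_inj' inj_on_def)
  next
    case False
    then show ?thesis
      by (auto simp: pmf_eq_0_set_pmf)
  qed
  show ?thesis
    by (simp add: step_pmf_def pmf_bind * integral_measure_pmf_real[of UNIV] bind_return_pmf
        if_distrib[of "\<lambda>x. x * _"] of_bool_def cong: if_cong)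
qed

lemma emeasure_run_measure_cylinder:
  fixes P :: "('s::finite, 'a::finite) kernel"
  shows "emeasure (run_measure P \<pi> s) {\<omega>. \<forall>t<n. \<omega> t = d t} =
     (\<Prod>t<n. ennreal (pmf (step_pmf P \<pi> s t d) (d t)))"
proof -
  let ?M = "\<lambda>_::nat. count_space (UNIV :: ('s \<times> 'a) set)"
  interpret IT: Ionescu_Tulcea "\<lambda>t \<omega>. measure_pmf (step_pmf P \<pi> s t \<omega>)" ?M
    by (rule Ionescu_Tulcea_step)
  have sets: "{restrict d {0..<m}} \<in> sets (PiM {0..<m} ?M)" for m
  proof -
    have "{restrict d {0..<m}} = PiE {0..<m} (\<lambda>t. {d t})"
      by (auto simp: PiE_iff extensional_def fun_eq_iff)
    then show ?thesis
      by (simp only:) (intro sets_PiM_I_finite, auto)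
  qed
  have C: "emeasure (IT.C 0 m (\<lambda>_. undefined)) {restrict d {0..<m}} =
      (\<Prod>t<m. ennreal (pmf (step_pmf P \<pi> s t d) (d t)))" for m
  proof (induction m)
    case 0
    show ?case
      using sets[of 0] by (simp add: restrict_def)
  next
    case (Suc m)
    let ?C = "IT.C 0 m (\<lambda>_. undefined)"
    have sp: "space ?C = space (PiM {0..<m} ?M)"
      using IT.space_C[of "\<lambda>_. undefined" 0 m] by simp
    have ss: "sets ?C = sets (PiM {0..<m} ?M)"
      using IT.sets_C[of "\<lambda>_. undefined" 0 m] by simp
    have "emeasure (IT.C 0 (Suc m) (\<lambda>_. undefined)) {restrict d {0..<Suc m}}
        = (\<integral>\<^sup>+\<omega>. emeasure (IT.eP m \<omega>) {restrict d {0..<Suc m}} \<partial>?C)"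
      using sets[of "Suc m"] IT.measurable_eP[of m]
      by (simp add: emeasure_bind[where N = "PiM {0..<Suc m} ?M"] sp measurable_cong_sets[OF ss refl])
    also have "\<dots> = (\<integral>\<^sup>+\<omega>. ennreal (pmf (step_pmf P \<pi> s m d) (d m)) * indicator {restrict d {0..<m}} \<omega> \<partial>?C)"
    proof (rule nn_integral_cong)
      fix \<omega> assume "\<omega> \<in> space ?C"
      then have \<omega>: "\<omega> \<in> space (PiM {0..<m} ?M)"
        by (simp add: sp)
      then have ext: "\<omega> \<in> extensional {0..<m}"
        by (simp add: space_PiM PiE_iff)
      have eq: "fun_upd \<omega> m y = restrict d {0..<Suc m} \<longleftrightarrow> y = d m \<and> \<omega> = restrict d {0..<m}" for y
      proof
        assume L: "fun_upd \<omega> m y = restrict d {0..<Suc m}"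
        have "\<omega> t = restrict d {0..<m} t" for t
          using fun_cong[OF L, of t] ext by (cases "t < m"; cases "t = m") (auto simp: extensional_def)
        moreover have "y = d m"
          using fun_cong[OF L, of m] by simp
        ultimately show "y = d m \<and> \<omega> = restrict d {0..<m}"
          by auto
      qed (auto simp: fun_eq_iff)
      have st: "step_pmf P \<pi> s m (restrict d {0..<m}) = step_pmf P \<pi> s m d"
        by (simp add: step_pmf_def)
      have "emeasure (IT.eP m \<omega>) {restrict d {0..<Suc m}}
          = emeasure (measure_pmf (step_pmf P \<pi> s m \<omega>)) {y. fun_upd \<omega> m y = restrict d {0..<Suc m}}"
        using IT.emeasure_eP[OF \<omega> sets[of "Suc m"]] by (simp add: vimage_def)
      also have "\<dots> = ennreal (pmf (step_pmf P \<pi> s m d) (d m)) * indicator {restrict d {0..<m}} \<omega>"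
        unfolding eq by (cases "\<omega> = restrict d {0..<m}") (simp_all add: st emeasure_pmf_single)
      finally show "emeasure (IT.eP m \<omega>) {restrict d {0..<Suc m}}
          = ennreal (pmf (step_pmf P \<pi> s m d) (d m)) * indicator {restrict d {0..<m}} \<omega>" .
    qed
    also have "\<dots> = ennreal (pmf (step_pmf P \<pi> s m d) (d m)) * emeasure ?C {restrict d {0..<m}}"
      using sets[of m] by (subst nn_integral_cmult_indicator) (simp_all add: ss)
    finally show ?case
      by (simp only: Suc.IH prod.lessThan_Suc mult.commute)
  qed
  have emb: "{\<omega>. \<forall>t<n. \<omega> t = d t} = IT.PF.emb UNIV {0..<n} {restrict d {0..<n}}"
  proof (intro set_eqI iffI)
    fix \<omega> assume "\<omega> \<in> IT.PF.emb UNIV {0..<n} {restrict d {0..<n}}"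
    then have eq: "restrict \<omega> {0..<n} = restrict d {0..<n}"
      by (simp only: prod_emb_iff singleton_iff)
    have "\<omega> t = d t" if "t < n" for t
      using fun_cong[OF eq, of t] that by simp
    then show "\<omega> \<in> {\<omega>. \<forall>t<n. \<omega> t = d t}"
      by blast
  next
    fix \<omega> assume "\<omega> \<in> {\<omega>. \<forall>t<n. \<omega> t = d t}"
    then show "\<omega> \<in> IT.PF.emb UNIV {0..<n} {restrict d {0..<n}}"
      by (simp add: prod_emb_iff fun_eq_iff)
  qed
  have "emeasure (run_measure P \<pi> s) {\<omega>. \<forall>t<n. \<omega> t = d t} = emeasure (IT.CI {0..<n}) {restrict d {0..<n}}"
    unfolding emb run_measure_def by (rule IT.lim) (simp_all only: sets finite_atLeastLessThan)
  also have "\<dots> = emeasure (IT.C 0 n (\<lambda>_. undefined)) {restrict d {0..<n}}"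
    using sets[of n] by (subst IT.emeasure_CI[where n = n]) (simp_all add: prod_emb_id PiE_iff)
  finally show ?thesis
    by (simp add: C)
qed

definition V_fun ::
  "('s::finite, 'a::finite) kernel \<Rightarrow> ('x \<Rightarrow> 's \<Rightarrow> 'a \<Rightarrow> real) \<Rightarrow> real \<Rightarrow> real \<Rightarrow>
    ('s, 'a) policy \<Rightarrow> 'x \<Rightarrow> 's \<Rightarrow> real" where
  "V_fun P r \<gamma> \<tau> \<pi> x s =
     (\<integral>\<omega>. (\<Sum>t. \<gamma> ^ t * (r x (fst (\<omega> t)) (snd (\<omega> t)) + \<tau> * policy_entropy (\<pi> (fst (\<omega> t)))))
       \<partial>run_measure P \<pi> s)"

definition Q_fun ::
  "('s::finite, 'a::finite) kernel \<Rightarrow> ('x \<Rightarrow> 's \<Rightarrow> 'a \<Rightarrow> real) \<Rightarrow> real \<Rightarrow> real \<Rightarrow>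
    ('s, 'a) policy \<Rightarrow> 'x \<Rightarrow> 's \<Rightarrow> 'a \<Rightarrow> real" where
  "Q_fun P r \<gamma> \<tau> \<pi> x s a =
     r x s a + \<gamma> * (\<Sum>s'\<in>UNIV. pmf (P s a) s' * V_fun P r \<gamma> \<tau> \<pi> x s')"

text \<open>A policy is a function into \<open>'a pmf\<close>, so the quantifier over \<open>\<pi>'\<close> ranges over all policies.
  The maximizer is unique when all weights \<open>pmf \<rho> s\<close> are positive.\<close>

definition opt_policy ::
  "('s::finite, 'a::finite) kernel \<Rightarrow> ('x \<Rightarrow> 's \<Rightarrow> 'a \<Rightarrow> real) \<Rightarrow> real \<Rightarrow> real \<Rightarrow> 's pmf \<Rightarrow>
    'x \<Rightarrow> ('s, 'a) policy" where
  "opt_policy P r \<gamma> \<tau> \<rho> x =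
     (THE \<pi>. \<forall>\<pi>'. (\<Sum>s\<in>UNIV. pmf \<rho> s * V_fun P r \<gamma> \<tau> \<pi>' x s)
                \<le> (\<Sum>s\<in>UNIV. pmf \<rho> s * V_fun P r \<gamma> \<tau> \<pi> x s))"

definition V_opt ::
  "('s::finite, 'a::finite) kernel \<Rightarrow> ('x \<Rightarrow> 's \<Rightarrow> 'a \<Rightarrow> real) \<Rightarrow> real \<Rightarrow> real \<Rightarrow> 's pmf \<Rightarrow>
    'x \<Rightarrow> 's \<Rightarrow> real" where
  "V_opt P r \<gamma> \<tau> \<rho> x s = V_fun P r \<gamma> \<tau> (opt_policy P r \<gamma> \<tau> \<rho> x) x s"

definition Q_opt ::
  "('s::finite, 'a::finite) kernel \<Rightarrow> ('x \<Rightarrow> 's \<Rightarrow> 'a \<Rightarrow> real) \<Rightarrow> real \<Rightarrow> real \<Rightarrow> 's pmf \<Rightarrow>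
    'x \<Rightarrow> 's \<Rightarrow> 'a \<Rightarrow> real" where
  "Q_opt P r \<gamma> \<tau> \<rho> x s a = Q_fun P r \<gamma> \<tau> (opt_policy P r \<gamma> \<tau> \<rho> x) x s a"

definition traj_prob ::
  "'s pmf \<Rightarrow> ('s, 'a) kernel \<Rightarrow> nat \<Rightarrow> ('s, 'a) policy \<Rightarrow> ('s \<times> 'a) list \<Rightarrow> real" where
  "traj_prob \<rho>' P' H \<pi> d =
     pmf \<rho>' (fst (d ! 0)) *
     (\<Prod>h<H - 1. pmf (\<pi> (fst (d ! h))) (snd (d ! h)) *
        pmf (P' (fst (d ! h)) (snd (d ! h))) (fst (d ! Suc h))) *
     pmf (\<pi> (fst (d ! (H - 1)))) (snd (d ! (H - 1)))"

definition traj_pmf ::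
  "'s pmf \<Rightarrow> ('s, 'a) kernel \<Rightarrow> nat \<Rightarrow> ('s, 'a) policy \<Rightarrow> ('s \<times> 'a) list pmf" where
  "traj_pmf \<rho>' P' H \<pi> = embed_pmf (\<lambda>d. if length d = H then traj_prob \<rho>' P' H \<pi> d else 0)"

lemma sum_traj_prob:
  fixes P' :: "('s::finite, 'a::finite) kernel"
  shows "(\<Sum>d | length d = Suc n. traj_prob \<rho>' P' (Suc n) \<pi> d) = 1"
proof (induction n)
  case 0
  have "bij_betw (\<lambda>y. [y]) (UNIV :: ('s \<times> 'a) set) {d. length d = Suc 0}"
    by (auto simp: bij_betw_def inj_on_def length_Suc_conv)
  then have "(\<Sum>d | length d = Suc 0. traj_prob \<rho>' P' (Suc 0) \<pi> d) =
      (\<Sum>y\<in>UNIV. pmf \<rho>' (fst y) * pmf (\<pi> (fst y)) (snd y))"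
    by (subst sum.reindex_bij_betw[symmetric]) (auto simp: traj_prob_def)
  also have "\<dots> = (\<Sum>s\<in>UNIV. pmf \<rho>' s * (\<Sum>a\<in>UNIV. pmf (\<pi> s) a))"
    by (simp add: UNIV_Times_UNIV[symmetric] sum.cartesian_product' sum_distrib_left case_prod_unfold
        del: UNIV_Times_UNIV)
  also have "\<dots> = 1"
    by (simp add: sum_pmf_eq_1)
  finally show ?case .
next
  case (Suc n)
  have "bij_betw (\<lambda>(d, y). d @ [y]) ({d. length d = Suc n} \<times> (UNIV :: ('s \<times> 'a) set))
      {d. length d = Suc (Suc n)}"
    by (rule bij_betwI[where g = "\<lambda>d. (butlast d, last d)"])
      (auto intro!: append_butlast_last_id)
  then have "(\<Sum>d | length d = Suc (Suc n). traj_prob \<rho>' P' (Suc (Suc n)) \<pi> d) =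
      (\<Sum>(d, y)\<in>{d. length d = Suc n} \<times> UNIV. traj_prob \<rho>' P' (Suc (Suc n)) \<pi> (d @ [y]))"
    by (subst sum.reindex_bij_betw[symmetric]) (auto simp: case_prod_unfold)
  also have "\<dots> = (\<Sum>(d, y)\<in>{d. length d = Suc n} \<times> UNIV.
      traj_prob \<rho>' P' (Suc n) \<pi> d * (pmf (P' (fst (d ! n)) (snd (d ! n))) (fst y) * pmf (\<pi> (fst y)) (snd y)))"
    by (rule sum.cong) (auto simp: traj_prob_def nth_append intro!: prod.cong)
  also have "\<dots> = (\<Sum>d | length d = Suc n. traj_prob \<rho>' P' (Suc n) \<pi> d *
      (\<Sum>s\<in>UNIV. pmf (P' (fst (d ! n)) (snd (d ! n))) s * (\<Sum>a\<in>UNIV. pmf (\<pi> s) a)))"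
    by (simp add: UNIV_Times_UNIV[symmetric] sum.cartesian_product' sum_distrib_left case_prod_unfold
        del: UNIV_Times_UNIV)
  also have "\<dots> = 1"
    by (simp add: sum_pmf_eq_1 Suc)
  finally show ?case .
qed

lemma pmf_traj_pmf:
  fixes P' :: "('s::finite, 'a::finite) kernel"
  assumes "1 \<le> H"
  shows "pmf (traj_pmf \<rho>' P' H \<pi>) d = (if length d = H then traj_prob \<rho>' P' H \<pi> d else 0)"
  unfolding traj_pmf_def
proof (rule pmf_embed_pmf)
  have nonneg: "0 \<le> traj_prob \<rho>' P' H \<pi> d" for d
    unfolding traj_prob_def by (intro mult_nonneg_nonneg prod_nonneg) auto
  then show "0 \<le> (if length d = H then traj_prob \<rho>' P' H \<pi> d else 0)" for d
    by simp
  have fin: "finite {d :: ('s \<times> 'a) list. length d = H}"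
    using finite_lists_length_eq[of "UNIV :: ('s \<times> 'a) set" H] by simp
  have "(\<integral>\<^sup>+d. ennreal (if length d = H then traj_prob \<rho>' P' H \<pi> d else 0) \<partial>count_space UNIV)
      = (\<integral>\<^sup>+d. ennreal (traj_prob \<rho>' P' H \<pi> d) \<partial>count_space {d. length d = H})"
    by (subst (2) nn_integral_count_space_indicator) (auto intro!: nn_integral_cong)
  also have "\<dots> = ennreal (\<Sum>d | length d = H. traj_prob \<rho>' P' H \<pi> d)"
    using fin nonneg by (simp add: nn_integral_count_space_finite sum_ennreal)
  also have "\<dots> = 1"
    using sum_traj_prob[of \<rho>' P' "H - 1" \<pi>] assms by simp
  finally show "(\<integral>\<^sup>+d. ennreal (if length d = H then traj_prob \<rho>' P' H \<pi> d else 0) \<partial>count_space UNIV) = 1" .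
qed

text \<open>The \<open>I\<close> trajectories are independent. A sample \<open>(d\<^sub>1, \<dots>, d\<^sub>I)\<close> is a list of length \<open>I\<close>, with \<open>d\<^sub>i\<close> at position \<open>i - 1\<close>.\<close>

definition upper_expectation ::
  "'s pmf \<Rightarrow> ('s, 'a) kernel \<Rightarrow> nat \<Rightarrow> nat \<Rightarrow> ('s, 'a) policy \<Rightarrow>
    (('s \<times> 'a) list list \<Rightarrow> 'b::{banach, second_countable_topology}) \<Rightarrow> 'b" where
  "upper_expectation \<rho>' P' I H \<pi> g =
     measure_pmf.expectation (replicate_pmf I (traj_pmf \<rho>' P' H \<pi>)) g"

definition upper_obj ::
  "'s pmf \<Rightarrow> ('s, 'a) kernel \<Rightarrow> nat \<Rightarrow> nat \<Rightarrow> (('s \<times> 'a) list list \<Rightarrow> 'x \<Rightarrow> real) \<Rightarrow>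
    'x \<Rightarrow> ('s, 'a) policy \<Rightarrow> real" where
  "upper_obj \<rho>' P' I H l x \<pi> = upper_expectation \<rho>' P' I H \<pi> (\<lambda>ds. l ds x)"

end

theory Submission
  imports Defs
begin

text \<open>
  The optimal value \<open>V\<^sup>*\<close> is the fixed point of the soft Bellman operator
  \<open>v \<mapsto> \<tau> log \<Sum>\<^sub>a exp ((r\<^sub>s\<^sub>a + \<gamma> \<Sum>\<^sub>t P\<^sub>s\<^sub>a\<^sub>t v\<^sub>t) / \<tau>)\<close>, and by the equality case of Gibbs'
  variational principle the only maximizer is \<open>\<pi>\<^sup>*\<^sub>s\<^sub>a = exp ((Q\<^sup>*\<^sub>s\<^sub>a - V\<^sup>*\<^sub>s) / \<tau>)\<close>. Since the operator is a
  contraction that is smooth in \<open>x\<close>, \<open>V\<^sup>*\<close> is differentiable. The weight of a sample of trajectories is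
  then a constant times \<open>exp (\<Sum> (Q\<^sup>* - V\<^sup>*) / \<tau>)\<close>, so that its logarithmic derivative is the score in the
  second term of the hyper-gradient.
\<close>

section \<open>Contractions in the supremum norm\<close>

text \<open>Comparison principle under Blackwell's conditions (monotonicity and discounting). At a
  state where \<open>u - w\<close> attains its maximum \<open>M\<close>, the hypotheses give
  \<open>M \<le> \<gamma> * M\<close>, which forces \<open>M \<le> 0\<close>.\<close>

lemma discounted_comparison:
  fixes F :: "('s::finite \<Rightarrow> real) \<Rightarrow> 's \<Rightarrow> real"
  assumes "\<gamma> < 1"
    and F: "\<And>u w c s. \<forall>s. u s \<le> w s + c \<Longrightarrow> F u s \<le> F w s + \<gamma> * c"
    and u: "\<And>s. u s \<le> F u s" and w: "\<And>s. F w s \<le> w s"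
  shows "u s \<le> w s"
proof -
  define M where "M = Max (range (\<lambda>s. u s - w s))"
  have M: "u s - w s \<le> M" for s
    by (auto simp: M_def intro: Max_ge)
  have "M \<in> range (\<lambda>s. u s - w s)"
    unfolding M_def by (rule Max_in) auto
  then obtain s0 where s0: "M = u s0 - w s0"
    by auto
  have "F u s0 \<le> F w s0 + \<gamma> * M"
    using M by (intro F) (auto simp: algebra_simps)
  with s0 u[of s0] w[of s0] have "M \<le> \<gamma> * M"
    by linarith
  then have "0 \<le> (\<gamma> - 1) * M"
    by (simp add: algebra_simps)
  with \<open>\<gamma> < 1\<close> have "M \<le> 0"
    by (simp add: zero_le_mult_iff)
  with M[of s] show ?thesis
    by linarith
qed

text \<open>Banach's theorem by Picard iteration from 0, with the supremum norm expressed through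
  uniform bounds \<open>c\<close>. The codomain is a general Banach space because the result serves
  twice: for real values and for the vectors of their gradients.\<close>

lemma sup_contraction_fixpoint:
  fixes F :: "('s::finite \<Rightarrow> 'b::banach) \<Rightarrow> 's \<Rightarrow> 'b"
  assumes \<gamma>: "0 \<le> \<gamma>" "\<gamma> < 1"
    and F: "\<And>u w c s. \<forall>s. norm (u s - w s) \<le> c \<Longrightarrow> norm (F u s - F w s) \<le> \<gamma> * c"
  obtains v where "\<And>s. F v s = v s"
proof -
  define a where "a n = (F ^^ n) (\<lambda>_. 0)" for n
  have a_Suc: "a (Suc n) = F (a n)" for n
    by (simp add: a_def)
  define C where "C = Max (range (\<lambda>s. norm (a 1 s - a 0 s)))"
  have step: "norm (a (Suc n) s - a n s) \<le> C * \<gamma> ^ n" for n s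
  proof (induction n arbitrary: s)
    case 0
    show ?case
      by (auto simp: C_def intro: Max_ge)
  next
    case (Suc n)
    have "norm (F (a (Suc n)) s - F (a n) s) \<le> \<gamma> * (C * \<gamma> ^ n)"
      using Suc by (intro F) auto
    then show ?case
      by (simp add: a_Suc mult_ac)
  qed
  have "convergent (\<lambda>n. a n s)" for s
  proof -
    have "summable (\<lambda>n. C * \<gamma> ^ n)"
      using \<gamma> by (intro summable_mult summable_geometric) simp
    then have "summable (\<lambda>n. a (Suc n) s - a n s)"
      using step by (rule summable_comparison_test'[where N = 0])
    then have "convergent (\<lambda>n. (a n s - a 0 s) + a 0 s)"
      unfolding summable_iff_convergent sum_lessThan_telescope[of "\<lambda>n. a n s"]
      by (rule convergent_add[OF _ convergent_const])
    then show ?thesis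
      by simp
  qed
  then obtain v where v: "(\<lambda>n. a n s) \<longlonglongrightarrow> v s" for s
    unfolding convergent_def by metis
  have "F v s = v s" for s
  proof (rule LIMSEQ_unique)
    show "(\<lambda>n. a (Suc n) s) \<longlonglongrightarrow> v s"
      using v by (rule LIMSEQ_Suc)
    \<comment> \<open>The finite sum over the states bounds every coordinate and tends to 0, so it
      can play the role of \<open>c\<close> in the contraction hypothesis.\<close>
    have "(\<lambda>n. \<Sum>s\<in>UNIV. norm (a n s - v s)) \<longlonglongrightarrow> (\<Sum>s\<in>UNIV. norm (v s - v s))"
      by (intro tendsto_intros v)
    then have lim: "(\<lambda>n. \<gamma> * (\<Sum>s\<in>UNIV. norm (a n s - v s))) \<longlonglongrightarrow> 0"
      using tendsto_mult_left[of _ 0 sequentially \<gamma>] by simp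
    have "norm (a (Suc n) s - F v s) \<le> \<gamma> * (\<Sum>s\<in>UNIV. norm (a n s - v s))" for n
      unfolding a_Suc by (intro F allI member_le_sum) auto
    then have "(\<lambda>n. a (Suc n) s - F v s) \<longlonglongrightarrow> 0"
      by (intro Lim_null_comparison[OF _ lim]) simp
    then show "(\<lambda>n. a (Suc n) s) \<longlonglongrightarrow> F v s"
      by (simp add: LIM_zero_iff)
  qed
  then show ?thesis
    by (rule that)
qed

text \<open>An implicit function theorem without an inverse: the affine candidate
  \<open>w y = v x + \<langle>y - x, G\<rangle>\<close> is a fixed point of \<open>F y\<close> up to an error \<open>o(\<parallel>y - x\<parallel>)\<close>, hence
  by contraction it is that close to the true fixed point \<open>v y\<close>.\<close>

lemma GDERIV_contraction_fixpoint:
  fixes F :: "'x::real_inner \<Rightarrow> ('s::finite \<Rightarrow> real) \<Rightarrow> 's \<Rightarrow> real"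
  assumes \<gamma>: "\<gamma> < 1"
    and F: "\<And>y u w c s. \<forall>s. \<bar>u s - w s\<bar> \<le> c \<Longrightarrow> \<bar>F y u s - F y w s\<bar> \<le> \<gamma> * c"
    and v: "\<And>y s. F y (v y) s = v y s"
    and G: "\<And>s. GDERIV (\<lambda>y. F y (\<lambda>s'. v x s' + inner (y - x) (G s')) s) x :> G s"
  shows "GDERIV (\<lambda>y. v y s) x :> G s"
  unfolding gderiv_def has_derivative_at_alt
proof (intro conjI allI impI)
  show "bounded_linear (\<lambda>h. inner h (G s))"
    by (rule bounded_linear_inner_left)
  fix e :: real assume e: "0 < e"
  define w where "w y s = v x s + inner (y - x) (G s)" for y s
  have wx: "w x = v x"
    by (simp add: w_def fun_eq_iff)
  \<comment> \<open>The tolerance \<open>e * (1 - \<gamma>)\<close> anticipates the final division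
    by \<open>1 - \<gamma>\<close>, after which exactly \<open>e\<close> remains.\<close>
  have "\<exists>d>0. \<forall>y. norm (y - x) < d \<longrightarrow> \<bar>F y (w y) s - w y s\<bar> \<le> (e * (1 - \<gamma>)) * norm (y - x)" for s
  proof -
    have "0 < e * (1 - \<gamma>)"
      using e \<gamma> by simp
    then obtain d where "d > 0" "\<And>y. norm (y - x) < d \<Longrightarrow>
        norm (F y (w y) s - F x (w x) s - inner (y - x) (G s)) \<le> (e * (1 - \<gamma>)) * norm (y - x)"
      using G[of s] unfolding gderiv_def has_derivative_at_alt w_def[symmetric] by blast
    moreover have "F y (w y) s - F x (w x) s - inner (y - x) (G s) = F y (w y) s - w y s" for y
      by (simp add: wx v w_def)
    ultimately show ?thesis
      by auto
  qed
  then obtain d where d: "\<And>s. 0 < d s"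
    "\<And>s y. norm (y - x) < d s \<Longrightarrow> \<bar>F y (w y) s - w y s\<bar> \<le> (e * (1 - \<gamma>)) * norm (y - x)"
    by metis
  show "\<exists>d>0. \<forall>y. norm (y - x) < d \<longrightarrow> norm (v y s - v x s - inner (y - x) (G s)) \<le> e * norm (y - x)"
  proof (intro exI conjI allI impI)
    show "0 < Min (range d)"
      using d(1) by simp
    fix y assume y: "norm (y - x) < Min (range d)"
    define M where "M = Max (range (\<lambda>s. \<bar>v y s - w y s\<bar>))"
    have M: "\<bar>v y s - w y s\<bar> \<le> M" for s
      by (auto simp: M_def intro: Max_ge)
    have "M \<in> range (\<lambda>s. \<bar>v y s - w y s\<bar>)"
      unfolding M_def by (rule Max_in) auto
    then obtain s0 where s0: "M = \<bar>v y s0 - w y s0\<bar>"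
      by auto
    have "\<bar>F y (v y) s0 - F y (w y) s0\<bar> \<le> \<gamma> * M"
      using M by (intro F) auto
    moreover have "\<bar>F y (w y) s0 - w y s0\<bar> \<le> (e * (1 - \<gamma>)) * norm (y - x)"
      using y by (intro d(2)) auto
    ultimately have "M \<le> \<gamma> * M + (e * (1 - \<gamma>)) * norm (y - x)"
      unfolding v by (subst s0) linarith
    then have "(1 - \<gamma>) * M \<le> (1 - \<gamma>) * (e * norm (y - x))"
      by (simp add: algebra_simps)
    then have "M \<le> e * norm (y - x)"
      using \<gamma> by (simp add: mult_le_cancel_left)
    with M[of s] show "norm (v y s - v x s - inner (y - x) (G s)) \<le> e * norm (y - x)"
      by (simp add: w_def)
  qed
qed

section \<open>Gradients of finite sums and constant multiples\<close>

lemma GDERIV_sum: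
  assumes "\<And>i. i \<in> A \<Longrightarrow> GDERIV (f i) x :> D i"
  shows "GDERIV (\<lambda>y. \<Sum>i\<in>A. f i y) x :> (\<Sum>i\<in>A. D i)"
  using has_derivative_sum[of A f "\<lambda>i h. inner h (D i)" "at x"] assms
  by (simp add: gderiv_def inner_sum_right)

lemma GDERIV_cmult:
  assumes "GDERIV f x :> D"
  shows "GDERIV (\<lambda>y. c * f y) x :> c *\<^sub>R D"
  using GDERIV_mult[OF GDERIV_const[of c] assms] by simp

section \<open>Log-sum-exp and the entropy\<close>

text \<open>The optimal value of the one-step problem with entropy bonus; it is
  \<open>\<tau>\<close> times the log-partition function at temperature
  \<open>\<tau>\<close>.\<close>

definition log_sum_exp :: "real \<Rightarrow> ('a::finite \<Rightarrow> real) \<Rightarrow> real" where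
  "log_sum_exp \<tau> q = \<tau> * ln (\<Sum>a\<in>UNIV. exp (q a / \<tau>))"

lemma sum_exp_pos: "0 < (\<Sum>a\<in>UNIV. exp (q a / \<tau>) :: real)" for q :: "'a::finite \<Rightarrow> real"
  by (intro sum_pos) auto

lemma exp_log_sum_exp:
  assumes "0 < \<tau>"
  shows "exp (log_sum_exp \<tau> q / \<tau>) = (\<Sum>a\<in>UNIV. exp (q a / \<tau>))"
  using assms sum_exp_pos[of q \<tau>] by (simp add: log_sum_exp_def)

lemma sum_softmax:
  assumes "0 < \<tau>"
  shows "(\<Sum>a\<in>UNIV. exp ((q a - log_sum_exp \<tau> q) / \<tau>)) = 1"
  using exp_log_sum_exp[OF assms, of q] sum_exp_pos[of q \<tau>]
  by (simp add: diff_divide_distrib exp_diff flip: sum_divide_distrib)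

text \<open>Monotonicity and compatibility with constant shifts in one statement, the form that
  passes on to the Bellman operator. Under the exponential the shift \<open>c\<close> is the factor
  \<open>exp (c / \<tau>)\<close>.\<close>

lemma log_sum_exp_le:
  assumes "0 < \<tau>" and le: "\<And>a. q a \<le> q' a + c"
  shows "log_sum_exp \<tau> q \<le> log_sum_exp \<tau> q' + c"
proof -
  have "(\<Sum>a\<in>UNIV. exp (q a / \<tau>)) \<le> (\<Sum>a\<in>UNIV. exp (q' a / \<tau>) * exp (c / \<tau>))"
    using assms by (intro sum_mono) (simp add: divide_right_mono flip: exp_add add_divide_distrib)
  then have "exp (log_sum_exp \<tau> q / \<tau>) \<le> exp ((log_sum_exp \<tau> q' + c) / \<tau>)"
    using assms by (simp add: exp_log_sum_exp add_divide_distrib exp_add sum_distrib_right)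
  then show ?thesis
    using assms by (simp add: divide_le_cancel)
qed

text \<open>The chain rule produces the softmax weights. At the optimal values these are the
  probabilities of the optimal policy, so the linearized Bellman operator is a policy
  evaluation.\<close>

lemma GDERIV_log_sum_exp:
  assumes \<tau>: "0 < \<tau>" and q: "\<And>a. GDERIV (\<lambda>y. q y a) x :> D a"
  shows "GDERIV (\<lambda>y. log_sum_exp \<tau> (q y)) x :>
    (\<Sum>a\<in>UNIV. exp ((q x a - log_sum_exp \<tau> (q x)) / \<tau>) *\<^sub>R D a)"
proof -
  let ?Z = "\<Sum>a\<in>UNIV. exp (q x a / \<tau>)"
  have "GDERIV (\<lambda>y. exp (q y a / \<tau>)) x :> (exp (q x a / \<tau>) / \<tau>) *\<^sub>R D a" for a
    using \<tau> by (intro GDERIV_DERIV_compose[OF q]) (auto intro!: derivative_eq_intros)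
  then have "GDERIV (\<lambda>y. \<Sum>a\<in>UNIV. exp (q y a / \<tau>)) x :>
      (\<Sum>a\<in>UNIV. (exp (q x a / \<tau>) / \<tau>) *\<^sub>R D a)"
    by (rule GDERIV_sum)
  moreover have "DERIV (\<lambda>z. \<tau> * ln z) ?Z :> \<tau> / ?Z"
    using sum_exp_pos[of "q x" \<tau>] by (auto intro!: derivative_eq_intros)
  ultimately have "GDERIV (\<lambda>y. log_sum_exp \<tau> (q y)) x :>
      (\<tau> / ?Z) *\<^sub>R (\<Sum>a\<in>UNIV. (exp (q x a / \<tau>) / \<tau>) *\<^sub>R D a)"
    unfolding log_sum_exp_def by (rule GDERIV_DERIV_compose)
  moreover have "(\<tau> / ?Z) * (exp (q x a / \<tau>) / \<tau>) = exp ((q x a - log_sum_exp \<tau> (q x)) / \<tau>)" for a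
    using \<tau> by (simp add: diff_divide_distrib exp_diff exp_log_sum_exp)
  ultimately show ?thesis
    by (simp add: scaleR_sum_right)
qed

text \<open>For positive \<open>p\<close> this is \<open>ln z \<le> z - 1\<close> at
  \<open>z = g / p\<close>, where equality holds only at \<open>z = 1\<close>. For
  \<open>p = 0\<close> it reads \<open>0 \<le> g\<close>, and positivity of \<open>g\<close>
  excludes equality.\<close>

lemma entropy_term_le:
  fixes p g :: real
  assumes "0 \<le> p" "0 < g"
  shows "p * ln g - p * ln p \<le> g - p"
    and "p * ln g - p * ln p = g - p \<Longrightarrow> p = g"
proof -
  consider "p = 0" | "0 < p"
    using assms by linarith
  then have "p * ln g - p * ln p \<le> g - p \<and> (p * ln g - p * ln p = g - p \<longrightarrow> p = g)"
  proof cases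
    case 2
    have eq: "p * ln g - p * ln p = p * ln (g / p)" "g - p = p * (g / p - 1)"
      using 2 assms by (simp_all add: ln_div algebra_simps)
    have "ln (g / p) \<le> g / p - 1"
      using 2 assms by (intro ln_le_minus_one) simp
    moreover have "g / p = 1" if "ln (g / p) = g / p - 1"
      using 2 assms that by (intro ln_eq_minus_one) simp_all
    ultimately show ?thesis
      unfolding eq using 2 by (auto simp: mult_le_cancel_left)
  qed (use assms in auto)
  then show "p * ln g - p * ln p \<le> g - p" "p * ln g - p * ln p = g - p \<Longrightarrow> p = g"
    by auto
qed

text \<open>The gap between the two sides is \<open>\<tau>\<close> times the relative entropy of
  \<open>p\<close> with respect to the softmax distribution, hence nonnegative, and zero only if the
  two coincide.\<close>

lemma gibbs_variational:
  fixes p :: "'a::finite pmf"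
  assumes \<tau>: "0 < \<tau>"
  shows "(\<Sum>a\<in>UNIV. pmf p a * q a) + \<tau> * policy_entropy p \<le> log_sum_exp \<tau> q"
    and "(\<Sum>a\<in>UNIV. pmf p a * q a) + \<tau> * policy_entropy p = log_sum_exp \<tau> q \<longleftrightarrow>
      (\<forall>a. pmf p a = exp ((q a - log_sum_exp \<tau> q) / \<tau>))"
proof -
  let ?L = "log_sum_exp \<tau> q"
  define g where "g a = exp ((q a - ?L) / \<tau>)" for a
  \<comment> \<open>The added \<open>g a - pmf p a\<close> sums to 0, both being probability
    vectors, and makes each term of the relative entropy nonnegative by itself.\<close>
  define e where "e a = g a - pmf p a - (pmf p a * ln (g a) - pmf p a * ln (pmf p a))" for a
  have q: "q a = ?L + \<tau> * ln (g a)" for a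
    using \<tau> by (simp add: g_def)
  have one: "(\<Sum>a\<in>UNIV. pmf p a) = 1" "(\<Sum>a\<in>UNIV. g a) = 1"
    using \<tau> by (simp_all add: sum_pmf_eq_1 g_def sum_softmax)
  have "(\<Sum>a\<in>UNIV. pmf p a * q a) =
      ?L * (\<Sum>a\<in>UNIV. pmf p a) + \<tau> * (\<Sum>a\<in>UNIV. pmf p a * ln (g a))"
    by (subst q) (simp add: distrib_left sum.distrib sum_distrib_left mult_ac)
  then have pq: "(\<Sum>a\<in>UNIV. pmf p a * q a) = ?L + \<tau> * (\<Sum>a\<in>UNIV. pmf p a * ln (g a))"
    by (simp add: one)
  have sum_e: "(\<Sum>a\<in>UNIV. e a) = - (\<Sum>a\<in>UNIV. pmf p a * ln (g a)) - policy_entropy p"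
    by (simp add: e_def sum_subtractf one policy_entropy_def)
  have eq: "?L - ((\<Sum>a\<in>UNIV. pmf p a * q a) + \<tau> * policy_entropy p) = \<tau> * (\<Sum>a\<in>UNIV. e a)"
    unfolding pq sum_e by (simp add: algebra_simps)
  have e: "0 \<le> e a" "e a = 0 \<longleftrightarrow> pmf p a = g a" for a
    using entropy_term_le[of "pmf p a" "g a"] by (auto simp: e_def g_def)
  show "(\<Sum>a\<in>UNIV. pmf p a * q a) + \<tau> * policy_entropy p \<le> ?L"
    using eq \<tau> e(1) by (smt (verit) mult_nonneg_nonneg sum_nonneg)
  have "(\<Sum>a\<in>UNIV. pmf p a * q a) + \<tau> * policy_entropy p = ?L \<longleftrightarrow> (\<Sum>a\<in>UNIV. e a) = 0"
    using eq \<tau> by (smt (verit) mult_eq_0_iff)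
  also have "\<dots> \<longleftrightarrow> (\<forall>a. pmf p a = g a)"
    using e by (simp add: sum_nonneg_eq_0_iff)
  finally show "(\<Sum>a\<in>UNIV. pmf p a * q a) + \<tau> * policy_entropy p = ?L \<longleftrightarrow>
      (\<forall>a. pmf p a = exp ((q a - ?L) / \<tau>))"
    by (simp add: g_def)
qed

section \<open>Policy evaluation\<close>

lemma
  fixes P :: "('s::finite, 'a::finite) kernel"
  shows space_run_measure [simp]: "space (run_measure P \<pi> s) = UNIV"
    and prob_space_run_measure: "prob_space (run_measure P \<pi> s)"
proof -
  interpret IT: Ionescu_Tulcea "\<lambda>t \<omega>. measure_pmf (step_pmf P \<pi> s t \<omega>)"
      "\<lambda>_. count_space (UNIV :: ('s \<times> 'a) set)"
    by (rule Ionescu_Tulcea_step)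
  show "space (run_measure P \<pi> s) = UNIV"
    by (auto simp: run_measure_def space_PiM)
  \<comment> \<open>The cylinder of length 0 is the whole space, and its measure is the empty
    product.\<close>
  then show "prob_space (run_measure P \<pi> s)"
    using emeasure_run_measure_cylinder[of P \<pi> s 0] by (intro prob_spaceI) simp
qed

lemma run_measure_coordinate_measurable [measurable]:
  fixes P :: "('s::finite, 'a::finite) kernel"
  shows "(\<lambda>\<omega>. \<omega> t) \<in> run_measure P \<pi> s \<rightarrow>\<^sub>M count_space UNIV"
proof -
  interpret IT: Ionescu_Tulcea "\<lambda>t \<omega>. measure_pmf (step_pmf P \<pi> s t \<omega>)"
      "\<lambda>_. count_space (UNIV :: ('s \<times> 'a) set)"
    by (rule Ionescu_Tulcea_step)
  have sets: "sets (run_measure P \<pi> s) = sets (PiM UNIV (\<lambda>_. count_space UNIV))"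
    by (simp add: run_measure_def)
  show ?thesis
    unfolding measurable_cong_sets[OF sets refl] by (rule measurable_component_singleton) simp
qed

text \<open>The transition operator of the Markov chain of state-action pairs, acting on functions;
  its powers give expectations at later times.\<close>

definition next_expectation ::
  "('s::finite, 'a::finite) kernel \<Rightarrow> ('s, 'a) policy \<Rightarrow> ('s \<times> 'a \<Rightarrow> real) \<Rightarrow> 's \<times> 'a \<Rightarrow> real" where
  "next_expectation P \<pi> g y =
     (\<Sum>s'\<in>UNIV. pmf (P (fst y) (snd y)) s' * (\<Sum>a'\<in>UNIV. pmf (\<pi> s') a' * g (s', a')))"

text \<open>Summing out the last pair of a prefix replaces \<open>g\<close> by
  \<open>next_expectation P \<pi> g\<close> on the prefix shorter by one. Hence the induction on
  \<open>t\<close> leaves \<open>g\<close> arbitrary.\<close>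

lemma sum_prefixes_step_pmf:
  fixes P :: "('s::finite, 'a::finite) kernel"
  shows "(\<Sum>d | length d = Suc t. (\<Prod>i<Suc t. pmf (step_pmf P \<pi> s i ((!) d)) (d ! i)) * g (d ! t)) =
    (\<Sum>a\<in>UNIV. pmf (\<pi> s) a * (next_expectation P \<pi> ^^ t) g (s, a))"
proof (induction t arbitrary: g)
  case 0
  have "bij_betw (\<lambda>y. [y]) (UNIV :: ('s \<times> 'a) set) {d. length d = Suc 0}"
    by (auto simp: bij_betw_def inj_on_def length_Suc_conv)
  then have "(\<Sum>d | length d = Suc 0. (\<Prod>i<Suc 0. pmf (step_pmf P \<pi> s i ((!) d)) (d ! i)) * g (d ! 0)) =
      (\<Sum>y\<in>UNIV. of_bool (fst y = s) * pmf (\<pi> (fst y)) (snd y) * g y)"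
    by (subst sum.reindex_bij_betw[symmetric]) (auto simp: pmf_step_pmf intro!: sum.cong)
  also have "\<dots> = (\<Sum>s'\<in>UNIV. of_bool (s' = s) * (\<Sum>a\<in>UNIV. pmf (\<pi> s') a * g (s', a)))"
    by (simp add: UNIV_Times_UNIV[symmetric] sum.cartesian_product' sum_distrib_left mult.assoc
        del: UNIV_Times_UNIV)
  also have "\<dots> = (\<Sum>a\<in>UNIV. pmf (\<pi> s) a * g (s, a))"
    by (simp add: of_bool_def if_distrib[of "\<lambda>x. x * _"] cong: if_cong)
  finally show ?case
    by simp
next
  case (Suc t)
  let ?p = "\<lambda>n d. \<Prod>i<n. pmf (step_pmf P \<pi> s i ((!) d)) (d ! i)"
  have "bij_betw (\<lambda>(d, y). d @ [y]) ({d. length d = Suc t} \<times> (UNIV :: ('s \<times> 'a) set))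
      {d. length d = Suc (Suc t)}"
    by (rule bij_betwI[where g = "\<lambda>d. (butlast d, last d)"])
      (auto intro!: append_butlast_last_id)
  then have "(\<Sum>d | length d = Suc (Suc t). ?p (Suc (Suc t)) d * g (d ! Suc t)) =
      (\<Sum>(d, y)\<in>{d. length d = Suc t} \<times> UNIV. ?p (Suc (Suc t)) (d @ [y]) * g y)"
    by (subst sum.reindex_bij_betw[symmetric]) (auto simp: case_prod_unfold nth_append intro!: sum.cong)
  also have "\<dots> = (\<Sum>(d, y)\<in>{d. length d = Suc t} \<times> UNIV. ?p (Suc t) d *
      (pmf (P (fst (d ! t)) (snd (d ! t))) (fst y) * (pmf (\<pi> (fst y)) (snd y) * g y)))"
  proof (rule sum.cong[OF refl], clarify)
    fix d :: "('s \<times> 'a) list" and s' a'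
    assume d: "length d = Suc t"
    \<comment> \<open>The law of step \<open>i\<close> looks only at entry \<open>i - 1\<close>, so
      the appended pair does not affect the earlier factors.\<close>
    have "?p (Suc t) (d @ [(s', a')]) = ?p (Suc t) d"
      using d by (intro prod.cong) (auto simp: nth_append step_pmf_def)
    moreover have "pmf (step_pmf P \<pi> s (Suc t) ((!) (d @ [(s', a')]))) ((d @ [(s', a')]) ! Suc t) =
        pmf (P (fst (d ! t)) (snd (d ! t))) s' * pmf (\<pi> s') a'"
      using d by (simp add: nth_append pmf_step_pmf)
    ultimately show "?p (Suc (Suc t)) (d @ [(s', a')]) * g (s', a') = ?p (Suc t) d *
        (pmf (P (fst (d ! t)) (snd (d ! t))) (fst (s', a')) *
          (pmf (\<pi> (fst (s', a'))) (snd (s', a')) * g (s', a')))"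
      by (simp only: prod.lessThan_Suc[of _ "Suc t"] fst_conv snd_conv mult.assoc)
  qed
  also have "\<dots> = (\<Sum>d | length d = Suc t. ?p (Suc t) d * next_expectation P \<pi> g (d ! t))"
    by (simp add: UNIV_Times_UNIV[symmetric] sum.cartesian_product' sum_distrib_left case_prod_unfold
        next_expectation_def del: UNIV_Times_UNIV prod.lessThan_Suc)
  finally show ?case
    by (simp add: Suc.IH funpow_swap1 del: prod.lessThan_Suc)
qed

text \<open>The integrand depends on finitely many coordinates with finitely many values. It is
  therefore a finite combination of indicators of cylinders, whose probabilities are known.\<close>

lemma expectation_run_measure:
  fixes P :: "('s::finite, 'a::finite) kernel"
  shows "(\<integral>\<omega>. g (\<omega> t) \<partial>run_measure P \<pi> s) =
    (\<Sum>a\<in>UNIV. pmf (\<pi> s) a * (next_expectation P \<pi> ^^ t) g (s, a))"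
proof -
  let ?M = "run_measure P \<pi> s"
  interpret prob_space ?M
    by (rule prob_space_run_measure)
  let ?D = "{d :: ('s \<times> 'a) list. length d = Suc t}"
  let ?cyl = "\<lambda>d. {\<omega>. \<forall>i<Suc t. \<omega> i = d ! i}"
  have fin: "finite ?D"
    using finite_lists_length_eq[of "UNIV :: ('s \<times> 'a) set" "Suc t"] by simp
  have sets: "?cyl d \<in> sets ?M" for d
  proof -
    have "{\<omega> \<in> space ?M. \<forall>i\<in>{..<Suc t}. \<omega> i = d ! i} \<in> sets ?M"
      by measurable
    then show ?thesis
      by (simp add: lessThan_def)
  qed
  have meas: "measure ?M (?cyl d) = (\<Prod>i<Suc t. pmf (step_pmf P \<pi> s i ((!) d)) (d ! i))" for d
    using emeasure_run_measure_cylinder[of P \<pi> s "Suc t" "(!) d"]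
    by (simp add: measure_def prod_ennreal prod_nonneg del: prod.lessThan_Suc)
  have "g (\<omega> t) = (\<Sum>d\<in>?D. indicator (?cyl d) \<omega> * g (d ! t))" for \<omega>
  proof -
    \<comment> \<open>The cylinders partition the space: \<open>\<omega>\<close> lies only in that
      of its own prefix.\<close>
    have "\<omega> \<in> ?cyl d \<longleftrightarrow> d = map \<omega> [0..<Suc t]" if "d \<in> ?D" for d
      using that by (auto simp: list_eq_iff_nth_eq simp del: upt_Suc)
    then have "(\<Sum>d\<in>?D. indicator (?cyl d) \<omega> * g (d ! t)) =
        (\<Sum>d\<in>?D. if d = map \<omega> [0..<Suc t] then g (d ! t) else 0)"
      by (intro sum.cong) auto
    also have "\<dots> = g (\<omega> t)"
      using fin by (simp add: nth_append)
    finally show ?thesis ..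
  qed
  then have "(\<integral>\<omega>. g (\<omega> t) \<partial>?M) = (\<integral>\<omega>. (\<Sum>d\<in>?D. indicator (?cyl d) \<omega> * g (d ! t)) \<partial>?M)"
    by (intro Bochner_Integration.integral_cong refl)
  also have "\<dots> = (\<Sum>d\<in>?D. measure ?M (?cyl d) * g (d ! t))"
    using sets by (subst Bochner_Integration.integral_sum)
      (auto simp: emeasure_eq_measure intro!: integrable_real_mult_indicator)
  also have "\<dots> = (\<Sum>a\<in>UNIV. pmf (\<pi> s) a * (next_expectation P \<pi> ^^ t) g (s, a))"
    unfolding meas by (rule sum_prefixes_step_pmf)
  finally show ?thesis .
qed

text \<open>Sum and integral may be exchanged because \<open>g\<close> takes finitely many values,
  so that the terms are dominated by a geometric series.\<close>

lemma discounted_return_sums: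
  fixes P :: "('s::finite, 'a::finite) kernel"
  assumes "0 < \<gamma>" "\<gamma> < 1"
  shows "(\<lambda>t. \<gamma> ^ t * (\<Sum>a\<in>UNIV. pmf (\<pi> s) a * (next_expectation P \<pi> ^^ t) g (s, a)))
    sums (\<integral>\<omega>. (\<Sum>t. \<gamma> ^ t * g (\<omega> t)) \<partial>run_measure P \<pi> s)"
proof -
  let ?M = "run_measure P \<pi> s"
  interpret prob_space ?M
    by (rule prob_space_run_measure)
  define C where "C = Max (range (\<lambda>y. \<bar>g y\<bar>))"
  have C: "\<bar>g y\<bar> \<le> C" for y
    by (auto simp: C_def intro: Max_ge)
  have bound: "norm (\<gamma> ^ t * g y) \<le> \<gamma> ^ t * C" for t y
    using assms C by (simp add: abs_mult)
  have geo: "summable (\<lambda>t. \<gamma> ^ t * C)"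
    using assms by (intro summable_mult2 summable_geometric) simp
  have [measurable]: "(\<lambda>\<omega>. g (\<omega> t)) \<in> borel_measurable ?M" for t
    by measurable
  have int: "integrable ?M (\<lambda>\<omega>. \<gamma> ^ t * g (\<omega> t))" for t
    by (rule integrable_const_bound[where B = "\<gamma> ^ t * C"]) (use bound in auto)
  have "(\<integral>\<omega>. norm (\<gamma> ^ t * g (\<omega> t)) \<partial>?M) \<le> \<gamma> ^ t * C" for t
    using integral_mono[of ?M "\<lambda>\<omega>. norm (\<gamma> ^ t * g (\<omega> t))" "\<lambda>_. \<gamma> ^ t * C"] bound[of t] int[of t] prob_space
    by simp
  then have "summable (\<lambda>t. \<integral>\<omega>. norm (\<gamma> ^ t * g (\<omega> t)) \<partial>?M)"
    by (intro summable_comparison_test'[OF geo, where N = 0]) simp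
  then have "(\<lambda>t. \<integral>\<omega>. \<gamma> ^ t * g (\<omega> t) \<partial>?M) sums (\<integral>\<omega>. (\<Sum>t. \<gamma> ^ t * g (\<omega> t)) \<partial>?M)"
  proof (intro sums_integral int AE_I2)
    show "summable (\<lambda>t. norm (\<gamma> ^ t * g (\<omega> t)))" for \<omega>
      by (rule summable_comparison_test'[OF geo, where N = 0]) (subst real_norm_def, subst abs_norm_cancel, rule bound)
  qed
  then show ?thesis
    by (simp only: integral_mult_right_zero expectation_run_measure)
qed

text \<open>Rewards and continuation values are separate arguments, so that the same expression
  serves for the true action values, for arbitrary candidates \<open>v\<close> and for
  differentiation in both arguments.\<close>

definition q_value ::
  "('s::finite, 'a) kernel \<Rightarrow> real \<Rightarrow> ('s \<Rightarrow> 'a \<Rightarrow> real) \<Rightarrow> ('s \<Rightarrow> real) \<Rightarrow> 's \<Rightarrow> 'a \<Rightarrow> real" where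
  "q_value P \<gamma> R v s a = R s a + \<gamma> * (\<Sum>s'\<in>UNIV. pmf (P s a) s' * v s')"

text \<open>The expected rewards from time 1 on form \<open>\<gamma>\<close> times the averaged
  series of the successor state; adding the term of time 0 gives the whole value.\<close>

lemma V_fun_Bellman:
  fixes P :: "('s::finite, 'a::finite) kernel"
  assumes "0 < \<gamma>" "\<gamma> < 1"
  shows "V_fun P r \<gamma> \<tau> \<pi> x s =
    (\<Sum>a\<in>UNIV. pmf (\<pi> s) a * q_value P \<gamma> (r x) (V_fun P r \<gamma> \<tau> \<pi> x) s a) + \<tau> * policy_entropy (\<pi> s)"
proof -
  define g where "g y = r x (fst y) (snd y) + \<tau> * policy_entropy (\<pi> (fst y))" for y
  define e where "e t s = (\<Sum>a\<in>UNIV. pmf (\<pi> s) a * (next_expectation P \<pi> ^^ t) g (s, a))" for t s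
  let ?V = "V_fun P r \<gamma> \<tau> \<pi> x"
  have V: "(\<lambda>t. \<gamma> ^ t * e t s) sums ?V s" for s
    using discounted_return_sums[OF assms, of \<pi> s P g] by (simp add: e_def g_def V_fun_def)
  \<comment> \<open>The outermost application of \<open>next_expectation\<close> is the first
    transition, after which \<open>t\<close> further steps from \<open>s'\<close> remain.\<close>
  have e_Suc: "e (Suc t) s = (\<Sum>a\<in>UNIV. pmf (\<pi> s) a * (\<Sum>s'\<in>UNIV. pmf (P s a) s' * e t s'))" for t
    by (simp add: e_def next_expectation_def)
  have "(\<lambda>t. \<Sum>a\<in>UNIV. pmf (\<pi> s) a * (\<gamma> * (\<Sum>s'\<in>UNIV. pmf (P s a) s' * (\<gamma> ^ t * e t s')))) sums
      (\<Sum>a\<in>UNIV. pmf (\<pi> s) a * (\<gamma> * (\<Sum>s'\<in>UNIV. pmf (P s a) s' * ?V s')))"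
    by (intro sums_sum sums_mult V)
  moreover have "(\<Sum>a\<in>UNIV. pmf (\<pi> s) a * (\<gamma> * (\<Sum>s'\<in>UNIV. pmf (P s a) s' * (\<gamma> ^ t * e t s')))) =
      \<gamma> ^ Suc t * e (Suc t) s" for t
    by (simp add: e_Suc sum_distrib_left mult_ac)
  ultimately have "(\<lambda>t. \<gamma> ^ Suc t * e (Suc t) s) sums
      (\<Sum>a\<in>UNIV. pmf (\<pi> s) a * (\<gamma> * (\<Sum>s'\<in>UNIV. pmf (P s a) s' * ?V s')))"
    by simp
  then have "(\<lambda>t. \<gamma> ^ t * e t s) sums
      ((\<Sum>a\<in>UNIV. pmf (\<pi> s) a * (\<gamma> * (\<Sum>s'\<in>UNIV. pmf (P s a) s' * ?V s'))) + \<gamma> ^ 0 * e 0 s)"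
    by (rule sums_Suc)
  then have "?V s = (\<Sum>a\<in>UNIV. pmf (\<pi> s) a * (\<gamma> * (\<Sum>s'\<in>UNIV. pmf (P s a) s' * ?V s'))) + e 0 s"
    using sums_unique2[OF V[of s]] by simp
  also have "e 0 s = (\<Sum>a\<in>UNIV. pmf (\<pi> s) a * r x s a) + \<tau> * policy_entropy (\<pi> s)"
    by (simp add: e_def g_def distrib_left sum.distrib sum_pmf_eq_1 flip: sum_distrib_right)
  finally show ?thesis
    by (simp add: q_value_def distrib_left sum.distrib)
qed

section \<open>The optimal policy\<close>

lemma q_value_le:
  assumes "0 \<le> \<gamma>" and le: "\<forall>s. u s \<le> w s + c"
  shows "q_value P \<gamma> R u s a \<le> q_value P \<gamma> R w s a + \<gamma> * c"
proof -
  have "(\<Sum>s'\<in>UNIV. pmf (P s a) s' * u s') \<le> (\<Sum>s'\<in>UNIV. pmf (P s a) s' * (w s' + c))"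
    using le by (intro sum_mono mult_left_mono) auto
  also have "\<dots> = (\<Sum>s'\<in>UNIV. pmf (P s a) s' * w s') + c"
    by (simp add: distrib_left sum.distrib sum_pmf_eq_1 flip: sum_distrib_right)
  finally show ?thesis
    using mult_left_mono[OF _ assms(1)] by (fastforce simp: q_value_def distrib_left)
qed

definition soft_bellman ::
  "('s::finite, 'a::finite) kernel \<Rightarrow> real \<Rightarrow> real \<Rightarrow> ('s \<Rightarrow> 'a \<Rightarrow> real) \<Rightarrow> ('s \<Rightarrow> real) \<Rightarrow> 's \<Rightarrow> real" where
  "soft_bellman P \<gamma> \<tau> R v s = log_sum_exp \<tau> (q_value P \<gamma> R v s)"

lemma soft_bellman_le:
  assumes "0 \<le> \<gamma>" "0 < \<tau>" "\<forall>s. u s \<le> w s + c"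
  shows "soft_bellman P \<gamma> \<tau> R u s \<le> soft_bellman P \<gamma> \<tau> R w s + \<gamma> * c"
  unfolding soft_bellman_def using assms by (intro log_sum_exp_le q_value_le)

text \<open>The one-sided estimate applied in both directions.\<close>

lemma soft_bellman_contraction:
  assumes "0 \<le> \<gamma>" "0 < \<tau>" "\<forall>s. \<bar>u s - w s\<bar> \<le> c"
  shows "\<bar>soft_bellman P \<gamma> \<tau> R u s - soft_bellman P \<gamma> \<tau> R w s\<bar> \<le> \<gamma> * c"
proof -
  have le: "\<forall>s. u s \<le> w s + c" "\<forall>s. w s \<le> u s + c"
    using assms(3) by (smt (verit))+
  show ?thesis
    using soft_bellman_le[OF assms(1,2) le(1), of P R s] soft_bellman_le[OF assms(1,2) le(2), of P R s]
    by linarith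
qed

definition softmax_pmf :: "real \<Rightarrow> ('a::finite \<Rightarrow> real) \<Rightarrow> 'a pmf" where
  "softmax_pmf \<tau> q = embed_pmf (\<lambda>a. exp ((q a - log_sum_exp \<tau> q) / \<tau>))"

lemma pmf_softmax_pmf:
  assumes "0 < \<tau>"
  shows "pmf (softmax_pmf \<tau> q) a = exp ((q a - log_sum_exp \<tau> q) / \<tau>)"
  unfolding softmax_pmf_def
  by (rule pmf_embed_pmf) (simp_all add: nn_integral_count_space_finite sum_softmax[OF assms] sum_ennreal)

text \<open>By the Bellman equation and Gibbs' inequality, the value of any policy lies below its
  own image under the soft Bellman operator; comparison with the fixed point does the rest.\<close>

lemma V_fun_le_soft_bellman_fixpoint:
  assumes "0 < \<gamma>" "\<gamma> < 1" "0 < \<tau>"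
    and v: "\<And>s. soft_bellman P \<gamma> \<tau> (r x) v s = v s"
  shows "V_fun P r \<gamma> \<tau> \<pi> x s \<le> v s"
proof (rule discounted_comparison[OF assms(2)])
  show "V_fun P r \<gamma> \<tau> \<pi> x s \<le> soft_bellman P \<gamma> \<tau> (r x) (V_fun P r \<gamma> \<tau> \<pi> x) s" for s
    unfolding soft_bellman_def using assms by (subst V_fun_Bellman) (simp_all add: gibbs_variational(1))
qed (use assms in \<open>auto intro: soft_bellman_le\<close>)

text \<open>The equality case of Gibbs' principle makes \<open>v\<close> a solution of the linear
  Bellman equation of the softmax policy, which the value of that policy solves too.\<close>

lemma V_fun_softmax:
  assumes "0 < \<gamma>" "\<gamma> < 1" "0 < \<tau>"
    and v: "\<And>s. soft_bellman P \<gamma> \<tau> (r x) v s = v s"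
  shows "V_fun P r \<gamma> \<tau> (\<lambda>s. softmax_pmf \<tau> (q_value P \<gamma> (r x) v s)) x s = v s"
proof (rule antisym)
  define \<pi> where "\<pi> = (\<lambda>s. softmax_pmf \<tau> (q_value P \<gamma> (r x) v s))"
  define F where "F u s = (\<Sum>a\<in>UNIV. pmf (\<pi> s) a * q_value P \<gamma> (r x) u s a) + \<tau> * policy_entropy (\<pi> s)" for u s
  have F: "F u s \<le> F w s + \<gamma> * c" if "\<forall>s. u s \<le> w s + c" for u w c s
  proof -
    have "F u s \<le> (\<Sum>a\<in>UNIV. pmf (\<pi> s) a * (q_value P \<gamma> (r x) w s a + \<gamma> * c)) + \<tau> * policy_entropy (\<pi> s)"
      unfolding F_def using assms that by (intro add_right_mono sum_mono mult_left_mono q_value_le) auto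
    also have "\<dots> = F w s + \<gamma> * c"
      by (simp add: F_def distrib_left sum.distrib sum_pmf_eq_1 flip: sum_distrib_right)
    finally show ?thesis .
  qed
  have "F v s = v s" for s
  proof -
    have "F v s = log_sum_exp \<tau> (q_value P \<gamma> (r x) v s)"
      unfolding F_def \<pi>_def using assms by (subst gibbs_variational(2)) (simp_all add: pmf_softmax_pmf)
    with v show ?thesis
      by (simp add: soft_bellman_def)
  qed
  moreover have "F (V_fun P r \<gamma> \<tau> \<pi> x) s = V_fun P r \<gamma> \<tau> \<pi> x s" for s
    unfolding F_def by (rule V_fun_Bellman[OF assms(1,2), symmetric])
  ultimately have "v s \<le> V_fun P r \<gamma> \<tau> \<pi> x s"
    by (intro discounted_comparison[OF assms(2) F]) auto
  then show "v s \<le> V_fun P r \<gamma> \<tau> (\<lambda>s. softmax_pmf \<tau> (q_value P \<gamma> (r x) v s)) x s"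
    by (simp add: \<pi>_def)
qed (intro V_fun_le_soft_bellman_fixpoint assms)

text \<open>The softmax policy attains the upper bound \<open>v\<close> in every state at once.
  Another maximizer must do so too, and equality in Gibbs' principle then determines its
  probabilities.\<close>

lemma opt_policy_eq_softmax:
  assumes \<gamma>\<tau>: "0 < \<gamma>" "\<gamma> < 1" "0 < \<tau>"
    and v: "\<And>s. soft_bellman P \<gamma> \<tau> (r x) v s = v s"
    and \<rho>: "\<And>s. 0 < pmf \<rho> s"
  shows "opt_policy P r \<gamma> \<tau> \<rho> x = (\<lambda>s. softmax_pmf \<tau> (q_value P \<gamma> (r x) v s))"
  unfolding opt_policy_def
proof (rule the_equality)
  let ?V = "\<lambda>\<pi>. V_fun P r \<gamma> \<tau> \<pi> x"
  let ?\<pi> = "\<lambda>s. softmax_pmf \<tau> (q_value P \<gamma> (r x) v s)"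
  note le = V_fun_le_soft_bellman_fixpoint[where v = v and x = x and r = r and P = P, OF \<gamma>\<tau> v]
  note eq = V_fun_softmax[where v = v and x = x and r = r and P = P, OF \<gamma>\<tau> v]
  show "\<forall>\<pi>'. (\<Sum>s\<in>UNIV. pmf \<rho> s * ?V \<pi>' s) \<le> (\<Sum>s\<in>UNIV. pmf \<rho> s * ?V ?\<pi> s)"
    unfolding eq using le by (intro allI sum_mono mult_left_mono) auto
  fix \<pi> assume max: "\<forall>\<pi>'. (\<Sum>s\<in>UNIV. pmf \<rho> s * ?V \<pi>' s) \<le> (\<Sum>s\<in>UNIV. pmf \<rho> s * ?V \<pi> s)"
  have "(\<Sum>s\<in>UNIV. pmf \<rho> s * v s) \<le> (\<Sum>s\<in>UNIV. pmf \<rho> s * ?V \<pi> s)"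
    using max[rule_format, of ?\<pi>] by (simp only: eq)
  then have "(\<Sum>s\<in>UNIV. pmf \<rho> s * (v s - ?V \<pi> s)) \<le> 0"
    by (simp add: right_diff_distrib sum_subtractf)
  moreover have nonneg: "0 \<le> pmf \<rho> s * (v s - ?V \<pi> s)" for s
    using le by simp
  ultimately have "(\<Sum>s\<in>UNIV. pmf \<rho> s * (v s - ?V \<pi> s)) = 0"
    by (intro antisym sum_nonneg) auto
  then have "\<forall>s. pmf \<rho> s * (v s - ?V \<pi> s) = 0"
    using nonneg by (simp add: sum_nonneg_eq_0_iff)
  \<comment> \<open>Positive weights turn equality of the weighted sums into equality in each
    state.\<close>
  then have V: "?V \<pi> = v"
    using \<rho> by (auto simp: fun_eq_iff) (metis less_irrefl)
  show "\<pi> = ?\<pi>"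
  proof (intro ext pmf_eqI)
    fix s a
    have "(\<Sum>a\<in>UNIV. pmf (\<pi> s) a * q_value P \<gamma> (r x) v s a) + \<tau> * policy_entropy (\<pi> s) =
        log_sum_exp \<tau> (q_value P \<gamma> (r x) v s)"
      using V_fun_Bellman[OF \<gamma>\<tau>(1,2), of P r \<tau> \<pi> x s] v[of s] by (simp add: V soft_bellman_def)
    then show "pmf (\<pi> s) a = pmf (?\<pi> s) a"
      using \<gamma>\<tau> by (simp add: gibbs_variational(2) pmf_softmax_pmf)
  qed
qed

lemma Q_opt_eq_q_value: "Q_opt P r \<gamma> \<tau> \<rho> x = q_value P \<gamma> (r x) (V_opt P r \<gamma> \<tau> \<rho> x)"
  by (simp add: fun_eq_iff Q_opt_def Q_fun_def q_value_def V_opt_def)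

text \<open>A fixed point \<open>v\<close> exists by contraction and is the value of the optimal
  policy, hence equals \<open>V_opt\<close>. Being a fixed point, it is also the log-sum-exp that
  normalizes the softmax.\<close>

lemma
  fixes P :: "('s::finite, 'a::finite) kernel"
  assumes \<gamma>\<tau>: "0 < \<gamma>" "\<gamma> < 1" "0 < \<tau>" and \<rho>: "\<And>s. 0 < pmf \<rho> s"
  shows V_opt_fixpoint: "soft_bellman P \<gamma> \<tau> (r x) (V_opt P r \<gamma> \<tau> \<rho> x) s = V_opt P r \<gamma> \<tau> \<rho> x s"
    and pmf_opt_policy: "pmf (opt_policy P r \<gamma> \<tau> \<rho> x s) a =
      exp ((Q_opt P r \<gamma> \<tau> \<rho> x s a - V_opt P r \<gamma> \<tau> \<rho> x s) / \<tau>)"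
proof -
  obtain v where v: "\<And>s. soft_bellman P \<gamma> \<tau> (r x) v s = v s"
    by (rule sup_contraction_fixpoint[of \<gamma> "soft_bellman P \<gamma> \<tau> (r x)"])
      (use \<gamma>\<tau> in \<open>auto intro: soft_bellman_contraction\<close>)
  note opt = opt_policy_eq_softmax[where x = x and r = r and P = P, OF \<gamma>\<tau> v \<rho>]
  have V: "V_opt P r \<gamma> \<tau> \<rho> x = v"
    using V_fun_softmax[where x = x and r = r and P = P, OF \<gamma>\<tau> v] by (simp add: fun_eq_iff V_opt_def opt)
  show "soft_bellman P \<gamma> \<tau> (r x) (V_opt P r \<gamma> \<tau> \<rho> x) s = V_opt P r \<gamma> \<tau> \<rho> x s"
    by (simp add: V v)
  show "pmf (opt_policy P r \<gamma> \<tau> \<rho> x s) a =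
      exp ((Q_opt P r \<gamma> \<tau> \<rho> x s a - V_opt P r \<gamma> \<tau> \<rho> x s) / \<tau>)"
    using v[of s] \<gamma>\<tau> by (simp add: opt pmf_softmax_pmf Q_opt_eq_q_value V soft_bellman_def)
qed

section \<open>Differentiability of the optimal value\<close>

lemma GDERIV_q_value:
  assumes "\<And>s a. GDERIV (\<lambda>y. r y s a) x :> D s a" and "\<And>s. GDERIV (\<lambda>y. v y s) x :> G s"
  shows "GDERIV (\<lambda>y. q_value P \<gamma> (r y) (v y) s a) x :>
    D s a + \<gamma> *\<^sub>R (\<Sum>s'\<in>UNIV. pmf (P s a) s' *\<^sub>R G s')"
  unfolding q_value_def by (intro GDERIV_add GDERIV_cmult GDERIV_sum assms)

text \<open>The candidate gradients solve the linearized fixed point equation, which evaluates the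
  reward gradients under the optimal policy at \<open>x\<close> and is again a
  \<open>\<gamma>\<close>-contraction, now on vectors.\<close>

lemma V_opt_differentiable:
  fixes P :: "('s::finite, 'a::finite) kernel" and r :: "'x::euclidean_space \<Rightarrow> 's \<Rightarrow> 'a \<Rightarrow> real"
  assumes \<gamma>\<tau>: "0 < \<gamma>" "\<gamma> < 1" "0 < \<tau>" and \<rho>: "\<And>s. 0 < pmf \<rho> s"
    and r: "\<And>s a. (\<lambda>y. r y s a) differentiable (at x)"
  shows "(\<lambda>y. V_opt P r \<gamma> \<tau> \<rho> y s) differentiable (at x)"
proof -
  define D where "D s a = grad (\<lambda>y. r y s a) x" for s a
  have D: "GDERIV (\<lambda>y. r y s a) x :> D s a" for s a
    unfolding D_def using r by (rule GDERIV_grad)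
  let ?V = "V_opt P r \<gamma> \<tau> \<rho>" and ?\<pi> = "opt_policy P r \<gamma> \<tau> \<rho> x"
  let ?B = "\<lambda>G s a. D s a + \<gamma> *\<^sub>R (\<Sum>s'\<in>UNIV. pmf (P s a) s' *\<^sub>R G s')"
  define F where "F G s = (\<Sum>a\<in>UNIV. pmf (?\<pi> s) a *\<^sub>R ?B G s a)" for G s
  have contraction: "norm (F u s - F w s) \<le> \<gamma> * c"
    if c: "\<forall>s. norm (u s - w s) \<le> c" for u w :: "'s \<Rightarrow> 'x" and c s
  proof -
    have B: "norm (?B u s a - ?B w s a) \<le> \<gamma> * c" for a
    proof -
      have "norm (\<Sum>s'\<in>UNIV. pmf (P s a) s' *\<^sub>R (u s' - w s')) \<le> (\<Sum>s'\<in>UNIV. pmf (P s a) s' * c)"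
        using c by (intro sum_norm_le) (simp add: mult_left_mono)
      also have "\<dots> = c"
        by (simp add: sum_pmf_eq_1 flip: sum_distrib_right)
      finally have "norm (\<gamma> *\<^sub>R (\<Sum>s'\<in>UNIV. pmf (P s a) s' *\<^sub>R (u s' - w s'))) \<le> \<gamma> * c"
        using \<gamma>\<tau> by simp
      then show ?thesis
        by (simp add: scaleR_diff_right sum_subtractf)
    qed
    have "norm (\<Sum>a\<in>UNIV. pmf (?\<pi> s) a *\<^sub>R (?B u s a - ?B w s a)) \<le> (\<Sum>a\<in>UNIV. pmf (?\<pi> s) a * (\<gamma> * c))"
      using B by (intro sum_norm_le) (simp only: norm_scaleR abs_of_nonneg pmf_nonneg mult_left_mono)
    also have "\<dots> = \<gamma> * c"
      by (simp add: sum_pmf_eq_1 flip: sum_distrib_right)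
    finally show ?thesis
      by (simp only: F_def scaleR_diff_right sum_subtractf)
  qed
  obtain G where G: "\<And>s. F G s = G s"
    by (rule sup_contraction_fixpoint[of \<gamma> F]) (use \<gamma>\<tau> contraction in auto)
  have aff: "GDERIV (\<lambda>y. ?V x s + inner (y - x) (G s)) x :> G s" for s
    unfolding gderiv_def by (auto intro!: derivative_eq_intros)
  have affine: "GDERIV (\<lambda>y. soft_bellman P \<gamma> \<tau> (r y) (\<lambda>s'. ?V x s' + inner (y - x) (G s')) s) x :> G s" for s
  proof -
    let ?q = "\<lambda>y. q_value P \<gamma> (r y) (\<lambda>s'. ?V x s' + inner (y - x) (G s')) s"
    have "GDERIV (\<lambda>y. log_sum_exp \<tau> (?q y)) x :>
        (\<Sum>a\<in>UNIV. exp ((?q x a - log_sum_exp \<tau> (?q x)) / \<tau>) *\<^sub>R ?B G s a)"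
      by (intro GDERIV_log_sum_exp GDERIV_q_value D aff \<gamma>\<tau>)
    \<comment> \<open>At \<open>y = x\<close> the affine candidate is \<open>V_opt\<close> itself,
      so the softmax weights are the optimal policy and the gradient found above is
      \<open>F G s\<close>.\<close>
    moreover have "exp ((?q x a - log_sum_exp \<tau> (?q x)) / \<tau>) = pmf (?\<pi> s) a" for a
      using V_opt_fixpoint[OF \<gamma>\<tau> \<rho>, of P r x s]
      by (simp add: pmf_opt_policy[OF \<gamma>\<tau> \<rho>] Q_opt_eq_q_value soft_bellman_def)
    ultimately show ?thesis
      by (simp only: soft_bellman_def G flip: F_def)
  qed
  have "GDERIV (\<lambda>y. ?V y s) x :> G s"
  proof (rule GDERIV_contraction_fixpoint[where F = "\<lambda>y. soft_bellman P \<gamma> \<tau> (r y)" and v = ?V])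
    show "\<gamma> < 1"
      by (rule \<gamma>\<tau>)
    show "\<bar>soft_bellman P \<gamma> \<tau> (r y) u s - soft_bellman P \<gamma> \<tau> (r y) w s\<bar> \<le> \<gamma> * c"
      if "\<forall>s. \<bar>u s - w s\<bar> \<le> c" for y u w c s
      using \<gamma>\<tau> that by (intro soft_bellman_contraction) auto
    show "soft_bellman P \<gamma> \<tau> (r y) (?V y) s = ?V y s" for y s
      by (rule V_opt_fixpoint[OF \<gamma>\<tau> \<rho>])
  qed (rule affine)
  then show ?thesis
    unfolding gderiv_def by (rule differentiableI)
qed

section \<open>The hyper-gradient\<close>

lemma pmf_replicate_pmf:
  "pmf (replicate_pmf n p) xs = (if length xs = n then \<Prod>i<n. pmf p (xs ! i) else 0)"
proof (induction n arbitrary: xs)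
  case 0
  then show ?case
    by simp
next
  case (Suc n)
  \<comment> \<open>As the image of a product under the injective cons map, the law has point masses
    that factorize.\<close>
  have rep: "replicate_pmf (Suc n) p = map_pmf (\<lambda>(x, xs). x # xs) (pair_pmf p (replicate_pmf n p))"
    by (simp add: pair_pmf_def map_bind_pmf bind_return_pmf)
  show ?case
  proof (cases xs)
    case Nil
    then show ?thesis
      by (auto simp: rep pmf_eq_0_set_pmf simp del: replicate_pmf.simps)
  next
    case (Cons y ys)
    have "pmf (replicate_pmf (Suc n) p) ((\<lambda>(x, xs). x # xs) (y, ys)) = pmf p y * pmf (replicate_pmf n p) ys"
      unfolding rep by (subst pmf_map_inj') (auto simp: inj_on_def pmf_pair)
    then show ?thesis
      by (simp add: Cons Suc.IH prod.lessThan_Suc_shift del: replicate_pmf.simps prod.lessThan_Suc)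
  qed
qed

text \<open>All samples have the same shape, so the expectation is a sum over a finite set
  independent of the policy, and can be differentiated term by term.\<close>

lemma upper_expectation_eq_sum:
  fixes P' :: "('s::finite, 'a::finite) kernel"
  assumes "1 \<le> H"
  shows "upper_expectation \<rho>' P' I H \<pi> g =
    (\<Sum>ds | length ds = I \<and> (\<forall>d\<in>set ds. length d = H).
      (\<Prod>i<I. traj_prob \<rho>' P' H \<pi> (ds ! i)) *\<^sub>R g ds)"
proof -
  let ?S = "{ds :: ('s \<times> 'a) list list. length ds = I \<and> (\<forall>d\<in>set ds. length d = H)}"
  have "finite {d :: ('s \<times> 'a) list. length d = H}"
    using finite_lists_length_eq[of "UNIV :: ('s \<times> 'a) set" H] by simp
  then have fin: "finite ?S"
    by (intro finite_subset[OF _ finite_lists_length_eq[of "{d. length d = H}" I]]) auto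
  have len: "length d = H" if "d \<in> set_pmf (traj_pmf \<rho>' P' H \<pi>)" for d
    using that pmf_traj_pmf[OF assms, of \<rho>' P' \<pi> d] by (auto simp: set_pmf_iff split: if_splits)
  have "upper_expectation \<rho>' P' I H \<pi> g =
      (\<Sum>ds\<in>?S. pmf (replicate_pmf I (traj_pmf \<rho>' P' H \<pi>)) ds *\<^sub>R g ds)"
    unfolding upper_expectation_def
    by (rule integral_measure_pmf[OF fin]) (auto simp: set_replicate_pmf len)
  also have "\<dots> = (\<Sum>ds\<in>?S. (\<Prod>i<I. traj_prob \<rho>' P' H \<pi> (ds ! i)) *\<^sub>R g ds)"
    using assms by (intro sum.cong refl) (auto simp: pmf_replicate_pmf pmf_traj_pmf intro!: prod.cong)
  finally show ?thesis .
qed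

text \<open>Separates the dynamics from the policy. There are \<open>H - 1\<close> transitions but
  \<open>H\<close> actions; the factor of the last action joins the others in the exponent.\<close>

lemma traj_prob_exp:
  assumes "1 \<le> H" and \<pi>: "\<And>s a. pmf (\<pi> s) a = exp (A s a)"
  shows "traj_prob \<rho>' P' H \<pi> d =
    pmf \<rho>' (fst (d ! 0)) * (\<Prod>h<H - 1. pmf (P' (fst (d ! h)) (snd (d ! h))) (fst (d ! Suc h))) *
    exp (\<Sum>h<H. A (fst (d ! h)) (snd (d ! h)))"
proof -
  obtain n where "H = Suc n"
    using assms by (cases H) auto
  then show ?thesis
    by (simp add: traj_prob_def \<pi> prod.distrib exp_sum exp_add mult_ac)
qed

theorem proposition5p2:
  fixes P P' :: "('s::finite, 'a::finite) kernel"
    and r :: "real ^ 'n \<Rightarrow> 's \<Rightarrow> 'a \<Rightarrow> real"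
    and \<gamma> \<tau> :: real
    and \<rho> \<rho>' :: "'s pmf"
    and I H :: nat
    and l :: "('s \<times> 'a) list list \<Rightarrow> real ^ 'n \<Rightarrow> real"
    and x :: "real ^ 'n"
  assumes "0 < \<gamma>" "\<gamma> < 1" "0 < \<tau>"
    and "\<And>s a. cont_diff (\<lambda>y. r y s a)"
    and "\<And>s. 0 < pmf \<rho> s"
    and "1 \<le> I" "1 \<le> H"
    and "\<And>ds. length ds = I \<Longrightarrow> (\<forall>d\<in>set ds. length d = H) \<Longrightarrow> cont_diff (l ds)"
  shows "(\<forall>s. (\<lambda>y. V_opt P r \<gamma> \<tau> \<rho> y s) differentiable (at x)) \<and>
    (\<forall>s a. (\<lambda>y. Q_opt P r \<gamma> \<tau> \<rho> y s a) differentiable (at x)) \<and>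
    (GDERIV (\<lambda>y. upper_obj \<rho>' P' I H l y (opt_policy P r \<gamma> \<tau> \<rho> y)) x :>
      upper_expectation \<rho>' P' I H (opt_policy P r \<gamma> \<tau> \<rho> x) (\<lambda>ds. grad (l ds) x) +
      (1 / \<tau>) *\<^sub>R upper_expectation \<rho>' P' I H (opt_policy P r \<gamma> \<tau> \<rho> x)
        (\<lambda>ds. l ds x *\<^sub>R
          (\<Sum>i<I. \<Sum>h<H. grad (\<lambda>y. Q_opt P r \<gamma> \<tau> \<rho> y (fst (ds ! i ! h)) (snd (ds ! i ! h))
                                   - V_opt P r \<gamma> \<tau> \<rho> y (fst (ds ! i ! h))) x)))"
proof -
  let ?V = "V_opt P r \<gamma> \<tau> \<rho>" and ?Q = "Q_opt P r \<gamma> \<tau> \<rho>" and ?\<pi> = "opt_policy P r \<gamma> \<tau> \<rho>"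
  have r: "(\<lambda>y. r y s a) differentiable (at x)" for s a
    using assms(4) by (simp add: cont_diff_def)
  have V: "(\<lambda>y. ?V y s) differentiable (at x)" for s
    by (intro V_opt_differentiable assms r)
  have Q: "(\<lambda>y. ?Q y s a) differentiable (at x)" for s a
  proof -
    have "GDERIV (\<lambda>y. ?Q y s a) x :> grad (\<lambda>y. r y s a) x +
        \<gamma> *\<^sub>R (\<Sum>s'\<in>UNIV. pmf (P s a) s' *\<^sub>R grad (\<lambda>y. ?V y s') x)"
      unfolding Q_opt_eq_q_value by (intro GDERIV_q_value GDERIV_grad r V)
    then show ?thesis
      unfolding gderiv_def by (rule differentiableI)
  qed
  let ?A = "\<lambda>s a y. ?Q y s a - ?V y s"
  let ?S = "{ds :: ('s \<times> 'a) list list. length ds = I \<and> (\<forall>d\<in>set ds. length d = H)}"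
  let ?p = "\<lambda>ds y. \<Prod>i<I. traj_prob \<rho>' P' H (?\<pi> y) (ds ! i)"
  let ?score = "\<lambda>ds. \<Sum>i<I. \<Sum>h<H. grad (?A (fst (ds ! i ! h)) (snd (ds ! i ! h))) x"
  have A: "GDERIV (?A s a) x :> grad (?A s a) x" for s a
    by (intro GDERIV_grad differentiable_diff V Q)
  have p: "GDERIV (?p ds) x :> ?p ds x *\<^sub>R ((1 / \<tau>) *\<^sub>R ?score ds)" for ds
  proof -
    \<comment> \<open>\<open>b\<close> collects the initial and transition probabilities, which do
      not vary with \<open>y\<close>. Writing the weight as \<open>b * exp (E y)\<close> gives the
      score without dividing by the weight, also for samples of probability 0.\<close>
    define b where "b = (\<Prod>i<I. pmf \<rho>' (fst (ds ! i ! 0)) *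
      (\<Prod>h<H - 1. pmf (P' (fst (ds ! i ! h)) (snd (ds ! i ! h))) (fst (ds ! i ! Suc h))))"
    define E where "E y = 1 / \<tau> * (\<Sum>i<I. \<Sum>h<H. ?A (fst (ds ! i ! h)) (snd (ds ! i ! h)) y)" for y
    have p_eq: "?p ds y = b * exp (E y)" for y
      by (simp add: b_def E_def prod.distrib sum_divide_distrib exp_sum
          traj_prob_exp[OF assms(7) pmf_opt_policy[OF assms(1-3,5)]])
    have "GDERIV E x :> (1 / \<tau>) *\<^sub>R ?score ds"
      unfolding E_def by (intro GDERIV_cmult GDERIV_sum A)
    \<comment> \<open>The exponential is its own derivative, so the weight returns as a factor and
      the result is again an expectation.\<close>
    moreover have "DERIV (\<lambda>z. b * exp z) (E x) :> b * exp (E x)"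
      by (auto intro!: derivative_eq_intros)
    ultimately show ?thesis
      unfolding p_eq by (rule GDERIV_DERIV_compose)
  qed
  \<comment> \<open>Smoothness of \<open>l\<close> is assumed only for samples of the right shape,
    which are those in the sum.\<close>
  have "GDERIV (l ds) x :> grad (l ds) x" if "ds \<in> ?S" for ds
    using that assms(8)[of ds] by (intro GDERIV_grad) (simp add: cont_diff_def)
  then have "GDERIV (\<lambda>y. \<Sum>ds\<in>?S. ?p ds y * l ds y) x :>
      (\<Sum>ds\<in>?S. ?p ds x *\<^sub>R grad (l ds) x + l ds x *\<^sub>R (?p ds x *\<^sub>R ((1 / \<tau>) *\<^sub>R ?score ds)))"
    by (intro GDERIV_sum GDERIV_mult p)
  then have "GDERIV (\<lambda>y. upper_obj \<rho>' P' I H l y (?\<pi> y)) x :>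
      upper_expectation \<rho>' P' I H (?\<pi> x) (\<lambda>ds. grad (l ds) x) +
      (1 / \<tau>) *\<^sub>R upper_expectation \<rho>' P' I H (?\<pi> x) (\<lambda>ds. l ds x *\<^sub>R ?score ds)"
    unfolding upper_obj_def upper_expectation_eq_sum[OF assms(7)]
    by (simp only: sum.distrib scaleR_sum_right real_scaleR_def scaleR_scaleR mult_ac)
  with V Q show ?thesis
    by blast
qed

end
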